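(* Consider an instance with $K=2$ scenarios and any number $m$ of machines, and suppose the jobs are given sorted in order of non-increasing weight $w_1\ge\dots\ge w_n$. Then one can compute, in time linear in $n$, an assignment $\varphi:[n]\to[m]$ that is simultaneously optimal for both scenarios, i.e. $G(\varphi,1)=\min_{\psi:[n]\to[m]}G(\psi,1)$ and $G(\varphi,2)=\min_{\psi:[n]\to[m]}G(\psi,2)$. In particular, MinMaxSTC and MinAvgSTC with two scenarios are solved optimally by such $\varphi$.
   Context: An instance consists of jobs $[n]$, machines $[m]$, non-negative job weights $w_1\ge w_2\ge\dots\ge w_n$, and scenarios $S_1,\dots,S_K\subseteq[n]$. A solution is an assignment $\varphi:[n]\to[m]$; write $J_i=\varphi^{-1}(i)$. The cost of $\varphi$ in scenario $k$ is $G(\varphi,k)=\sum_{i=1}^m\sum_{j\in J_i\cap S_k} w_j\cdot|\{j'\in J_i\cap S_k: j'\le j\}|$ (the total completion time of scenario $k$ when each machine processes its jobs from $S_k$ in Shortest-Processing-Time order with processing times $p_j=w_j$, skipping jobs not in $S_k$). MinMaxSTC asks to minimize $\max_k G(\varphi,k)$; MinAvgSTC asks to minimize $\sum_k G(\varphi,k)$. *)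

theory Defs
  imports Complex_Main "HOL-Library.FuncSet" "HOL-Library.Landau_Symbols"
begin

record stc_instance =
  num_jobs :: nat
  num_machines :: nat
  num_scenarios :: nat
  weight :: "nat \<Rightarrow> real"
  scenario :: "nat \<Rightarrow> nat set"

definition jobs :: "stc_instance \<Rightarrow> nat set" where
  "jobs I = {1..num_jobs I}"

definition machines :: "stc_instance \<Rightarrow> nat set" where
  "machines I = {1..num_machines I}"

definition scenario_indices :: "stc_instance \<Rightarrow> nat set" where
  "scenario_indices I = {1..num_scenarios I}"

definition valid_instance :: "stc_instance \<Rightarrow> bool" where
  "valid_instance I \<longleftrightarrow>
     num_machines I \<ge> 1 \<and> num_scenarios I \<ge> 1 \<and>
     (\<forall>j\<in>jobs I. weight I j \<ge> 0) \<and>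
     (\<forall>i\<in>jobs I. \<forall>j\<in>jobs I. i \<le> j \<longrightarrow> weight I i \<ge> weight I j) \<and>
     (\<forall>k\<in>scenario_indices I. scenario I k \<subseteq> jobs I)"

text \<open>The extensional function space makes the set of all assignments finite, so that the minima
  below can be expressed with \<^const>\<open>Min\<close>.\<close>

definition assignments :: "stc_instance \<Rightarrow> (nat \<Rightarrow> nat) set" where
  "assignments I = jobs I \<rightarrow>\<^sub>E machines I"

definition machine_jobs :: "stc_instance \<Rightarrow> (nat \<Rightarrow> nat) \<Rightarrow> nat \<Rightarrow> nat set" where
  "machine_jobs I \<phi> i = {j \<in> jobs I. \<phi> j = i}"

definition cost :: "stc_instance \<Rightarrow> (nat \<Rightarrow> nat) \<Rightarrow> nat \<Rightarrow> real" where
  "cost I \<phi> k =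
     (\<Sum>i\<in>machines I. \<Sum>j\<in>machine_jobs I \<phi> i \<inter> scenario I k.
        weight I j * real (card {j' \<in> machine_jobs I \<phi> i \<inter> scenario I k. j' \<le> j}))"

definition is_minimizer ::
  "stc_instance \<Rightarrow> ((nat \<Rightarrow> nat) \<Rightarrow> real) \<Rightarrow> (nat \<Rightarrow> nat) \<Rightarrow> bool" where
  "is_minimizer I f \<phi> \<longleftrightarrow> \<phi> \<in> assignments I \<and> f \<phi> = Min (f ` assignments I)"

definition scenario_optimal :: "stc_instance \<Rightarrow> nat \<Rightarrow> (nat \<Rightarrow> nat) \<Rightarrow> bool" where
  "scenario_optimal I k = is_minimizer I (\<lambda>\<psi>. cost I \<psi> k)"

definition MinMaxSTC_optimal :: "stc_instance \<Rightarrow> (nat \<Rightarrow> nat) \<Rightarrow> bool" where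
  "MinMaxSTC_optimal I = is_minimizer I (\<lambda>\<psi>. Max (cost I \<psi> ` scenario_indices I))"

definition MinAvgSTC_optimal :: "stc_instance \<Rightarrow> (nat \<Rightarrow> nat) \<Rightarrow> bool" where
  "MinAvgSTC_optimal I = is_minimizer I (\<lambda>\<psi>. \<Sum>k\<in>scenario_indices I. cost I \<psi> k)"

text \<open>Running time is the number of executed instructions of a unit-cost random access machine in
  the style of Cook and Reckhow. It has addition and truncated subtraction, but no multiplication,
  on its unbounded natural number cells \<open>nmem\<close>. A second bank of cells \<open>rmem\<close> holds real numbers, which
  can only be added, subtracted and compared; no instruction converts between the two sorts.
  The input consists of a read-only list of naturals and a read-only list of reals, accessible
  by index; the output is a write-only list of naturals.\<close>

datatype instr =
    Const nat nat
  | Add nat nat nat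
  | Sub nat nat nat
  | Load nat nat
  | Store nat nat
  | Jump nat nat
  | Read nat nat
  | Print nat
  | RAdd nat nat nat
  | RSub nat nat nat
  | RLoad nat nat
  | RStore nat nat
  | RJump nat nat
  | RRead nat nat

record config =
  pc :: nat
  nmem :: "nat \<Rightarrow> nat"
  rmem :: "nat \<Rightarrow> real"
  out :: "nat list"

definition initial_config :: config where
  "initial_config = \<lparr>pc = 0, nmem = (\<lambda>_. 0), rmem = (\<lambda>_. 0), out = []\<rparr>"

definition input_at :: "'a::zero list \<Rightarrow> nat \<Rightarrow> 'a" where
  "input_at xs a = (if a < length xs then xs ! a else 0)"

fun exec :: "nat list \<Rightarrow> real list \<Rightarrow> instr \<Rightarrow> config \<Rightarrow> config" where
  "exec xs ws (Const i c) s = s\<lparr>pc := pc s + 1, nmem := (nmem s)(i := c)\<rparr>"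
| "exec xs ws (Add i j k) s = s\<lparr>pc := pc s + 1, nmem := (nmem s)(i := nmem s j + nmem s k)\<rparr>"
| "exec xs ws (Sub i j k) s = s\<lparr>pc := pc s + 1, nmem := (nmem s)(i := nmem s j - nmem s k)\<rparr>"
| "exec xs ws (Load i j) s = s\<lparr>pc := pc s + 1, nmem := (nmem s)(i := nmem s (nmem s j))\<rparr>"
| "exec xs ws (Store i j) s = s\<lparr>pc := pc s + 1, nmem := (nmem s)(nmem s i := nmem s j)\<rparr>"
| "exec xs ws (Jump i l) s = s\<lparr>pc := (if nmem s i > 0 then l else pc s + 1)\<rparr>"
| "exec xs ws (Read i j) s = s\<lparr>pc := pc s + 1, nmem := (nmem s)(i := input_at xs (nmem s j))\<rparr>"
| "exec xs ws (Print i) s = s\<lparr>pc := pc s + 1, out := out s @ [nmem s i]\<rparr>"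
| "exec xs ws (RAdd i j k) s = s\<lparr>pc := pc s + 1, rmem := (rmem s)(i := rmem s j + rmem s k)\<rparr>"
| "exec xs ws (RSub i j k) s = s\<lparr>pc := pc s + 1, rmem := (rmem s)(i := rmem s j - rmem s k)\<rparr>"
| "exec xs ws (RLoad i j) s = s\<lparr>pc := pc s + 1, rmem := (rmem s)(i := rmem s (nmem s j))\<rparr>"
| "exec xs ws (RStore i j) s = s\<lparr>pc := pc s + 1, rmem := (rmem s)(nmem s i := rmem s j)\<rparr>"
| "exec xs ws (RJump i l) s = s\<lparr>pc := (if rmem s i > 0 then l else pc s + 1)\<rparr>"
| "exec xs ws (RRead i j) s = s\<lparr>pc := pc s + 1, rmem := (rmem s)(i := input_at ws (nmem s j))\<rparr>"

text \<open>A program halts when its program counter leaves the program. Halted configurations are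
  fixed points of \<open>step\<close>, so a machine halted after \<open>t\<close> steps is one that executes at most \<open>t\<close>
  instructions.\<close>

definition halted :: "instr list \<Rightarrow> config \<Rightarrow> bool" where
  "halted P s \<longleftrightarrow> pc s \<ge> length P"

definition step :: "instr list \<Rightarrow> nat list \<Rightarrow> real list \<Rightarrow> config \<Rightarrow> config" where
  "step P xs ws s = (if halted P s then s else exec xs ws (P ! pc s) s)"

definition outputs_within ::
  "instr list \<Rightarrow> nat list \<Rightarrow> real list \<Rightarrow> nat \<Rightarrow> nat list \<Rightarrow> bool" where
  "outputs_within P xs ws t ys \<longleftrightarrow>
     (let s = (step P xs ws ^^ t) initial_config in halted P s \<and> out s = ys)"

text \<open>The natural number input lists the three sizes and then one bit vector of length
  \<open>num_jobs I\<close> for each scenario. The real input lists the weights in the job order.\<close>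

definition job_list :: "stc_instance \<Rightarrow> nat list" where
  "job_list I = [1..<num_jobs I + 1]"

definition encode_nat :: "stc_instance \<Rightarrow> nat list" where
  "encode_nat I =
     [num_jobs I, num_machines I, num_scenarios I] @
     concat (map (\<lambda>k. map (\<lambda>j. of_bool (j \<in> scenario I k)) (job_list I))
       [1..<num_scenarios I + 1])"

definition encode_weights :: "stc_instance \<Rightarrow> real list" where
  "encode_weights I = map (weight I) (job_list I)"

definition encode_assignment :: "stc_instance \<Rightarrow> (nat \<Rightarrow> nat) \<Rightarrow> nat list" where
  "encode_assignment I \<phi> = map \<phi> (job_list I)"

definition computes_assignment_within ::
  "instr list \<Rightarrow> stc_instance \<Rightarrow> nat \<Rightarrow> (nat \<Rightarrow> nat) \<Rightarrow> bool" where
  "computes_assignment_within P I t \<phi> \<longleftrightarrow>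
     outputs_within P (encode_nat I) (encode_weights I) t (encode_assignment I \<phi>)"

end

theory Submission
  imports Defs
begin

text \<open>By Abel summation, an assignment is optimal for a scenario as soon as the job of rank \<open>r\<close>
  (counted from 0) occupies position \<open>r div m + 1\<close> on its machine. To achieve this in both scenarios,
  the jobs common to both scenarios go around the machines in increasing order, starting at the first
  one, and the remaining jobs of each scenario independently go around in decreasing order, starting
  at the last one. At any time the jobs of a scenario seen so far then occupy an interval of integers
  modulo \<open>m\<close>, so each new one goes to a machine of minimum load. The assignment depends on the jobs
  only through their membership in the scenarios, and counters modulo \<open>m\<close> suffice to compute it.\<close>

section \<open>The lower bound for a single scenario\<close>

text \<open>Abel summation: for each k the weighted sum up to k is at least \<open>w k\<close> times
  the prefix sum of \<open>d\<close>. That prefix sum is nonnegative, so passing to the smaller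
  weight \<open>w (Suc k)\<close> only lowers the bound.\<close>

lemma sum_antitone_weights_nonneg:
  fixes w d :: "nat \<Rightarrow> real"
  assumes "\<And>j. 1 \<le> j \<Longrightarrow> j < n \<Longrightarrow> w (Suc j) \<le> w j"
    and "\<And>j. 1 \<le> j \<Longrightarrow> j \<le> n \<Longrightarrow> 0 \<le> w j"
    and prefix: "\<And>k. k \<le> n \<Longrightarrow> 0 \<le> (\<Sum>j=1..k. d j)"
  shows "0 \<le> (\<Sum>j=1..n. w j * d j)"
proof -
  have "w k * (\<Sum>j=1..k. d j) \<le> (\<Sum>j=1..k. w j * d j)" if "1 \<le> k" "k \<le> n" for k
    using that
  proof (induction k rule: dec_induct)
    case base
    then show ?case by simp
  next
    case (step k)
    have "w (Suc k) * (\<Sum>j=1..k. d j) \<le> w k * (\<Sum>j=1..k. d j)"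
      using step.hyps step.prems assms(1) prefix by (intro mult_right_mono) auto
    also have "\<dots> \<le> (\<Sum>j=1..k. w j * d j)"
      using step by simp
    finally show ?case by (simp add: algebra_simps)
  qed
  moreover have "0 \<le> w n * (\<Sum>j=1..n. d j)" if "1 \<le> n"
    using assms(2) prefix that by simp
  ultimately show ?thesis
    by (cases "1 \<le> n") (auto intro: order_trans)
qed

text \<open>The case of equal weights. Among r + 1 jobs, pigeonhole gives a machine with more than r
  div \<open>card M\<close> of them; its last job has position at least r div \<open>card M\<close>
  + 1, and removing that job changes no other position.\<close>

lemma sum_positions_ge:
  fixes f :: "nat \<Rightarrow> 'a"
  assumes "finite A" "finite M" "M \<noteq> {}" "f ` A \<subseteq> M"
  shows "(\<Sum>r<card A. r div card M + 1) \<le> (\<Sum>j\<in>A. card {x \<in> A. f x = f j \<and> x \<le> j})"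
  using assms(1,4)
proof (induction "card A" arbitrary: A)
  case 0
  then show ?case by simp
next
  case (Suc r)
  have "\<exists>i\<in>M. r div card M < card {x \<in> A. f x = i}"
  proof (rule ccontr)
    assume "\<not> ?thesis"
    then have small: "card {x \<in> A. f x = i} \<le> r div card M" if "i \<in> M" for i
      using that by force
    have "Suc r = (\<Sum>i\<in>M. card {x \<in> A. f x = i})"
      using sum.group[OF Suc.prems(1) assms(2) Suc.prems(2), of "\<lambda>_. 1::nat"] Suc.hyps(2) by simp
    also have "\<dots> \<le> (\<Sum>i\<in>M. r div card M)"
      by (intro sum_mono small)
    also have "\<dots> \<le> r" by simp
    finally show False by simp
  qed
  then obtain i where i: "r div card M < card {x \<in> A. f x = i}" by blast
  define j where "j = Max {x \<in> A. f x = i}"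
  have ne: "{x \<in> A. f x = i} \<noteq> {}"
    using i by force
  have j: "j \<in> A" "f j = i" and j_max: "\<And>x. x \<in> A \<Longrightarrow> f x = i \<Longrightarrow> x \<le> j"
    using Max_in[OF _ ne] Suc.prems(1) unfolding j_def by auto
  have card': "r = card (A - {j})"
    using Suc.hyps(2) Suc.prems(1) j by simp
  have last: "{x \<in> A. f x = f j \<and> x \<le> j} = {x \<in> A. f x = i}"
    using j j_max by auto
  have others: "{x \<in> A. f x = f y \<and> x \<le> y} = {x \<in> A - {j}. f x = f y \<and> x \<le> y}"
    if "y \<in> A - {j}" for y
    using that j j_max[of y] by force
  have "(\<Sum>s<card A. s div card M + 1) = (\<Sum>s<r. s div card M + 1) + (r div card M + 1)"
    using Suc.hyps(2)[symmetric] by simp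
  also have "\<dots> \<le> (\<Sum>y\<in>A - {j}. card {x \<in> A - {j}. f x = f y \<and> x \<le> y})
      + card {x \<in> A. f x = f j \<and> x \<le> j}"
    using Suc.hyps(1)[OF card'] Suc.prems i card' last by fastforce
  also have "\<dots> = (\<Sum>y\<in>A. card {x \<in> A. f x = f y \<and> x \<le> y})"
    using others by (simp add: sum.remove[OF Suc.prems(1) j(1)])
  finally show ?case .
qed

text \<open>Peeling off the maximum, which has rank \<open>card A - 1\<close>, leaves all other
  ranks unchanged.\<close>

lemma sum_rank:
  fixes h :: "nat \<Rightarrow> 'a::comm_monoid_add" and A :: "'b::linorder set"
  assumes "finite A"
  shows "(\<Sum>j\<in>A. h (card {x \<in> A. x < j})) = (\<Sum>r<card A. h r)"
  using assms
proof (induction "card A" arbitrary: A)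
  case 0
  then show ?case by simp
next
  case (Suc r)
  define j where "j = Max A"
  have "A \<noteq> {}" using Suc.hyps(2) by auto
  then have j: "j \<in> A" and j_max: "\<And>x. x \<in> A \<Longrightarrow> x \<le> j"
    using Suc.prems unfolding j_def by simp_all
  have card': "r = card (A - {j})"
    using Suc.hyps(2) Suc.prems j by simp
  have "{x \<in> A. x < j} = A - {j}"
    using j_max by force
  moreover have "{x \<in> A. x < y} = {x \<in> A - {j}. x < y}" if "y \<in> A - {j}" for y
    using that j_max[of y] by force
  ultimately show ?case
    using Suc.hyps(1)[OF card'] Suc.prems card' Suc.hyps(2)[symmetric]
    by (simp add: sum.remove[OF Suc.prems j] add.commute)
qed

lemma cost_eq_sum_positions:
  assumes "\<psi> \<in> assignments I" "scenario I k \<subseteq> jobs I"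
  shows "cost I \<psi> k =
    (\<Sum>j\<in>scenario I k. weight I j * real (card {x \<in> scenario I k. \<psi> x = \<psi> j \<and> x \<le> j}))"
proof -
  let ?S = "scenario I k"
  let ?g = "\<lambda>j. weight I j * real (card {x \<in> ?S. \<psi> x = \<psi> j \<and> x \<le> j})"
  have fin: "finite ?S" "finite (machines I)"
    using assms(2) finite_subset by (auto simp: jobs_def machines_def)
  have img: "\<psi> ` ?S \<subseteq> machines I"
    using assms by (auto simp: assignments_def)
  have "cost I \<psi> k = (\<Sum>i\<in>machines I. \<Sum>j\<in>{j \<in> ?S. \<psi> j = i}. ?g j)"
    unfolding cost_def machine_jobs_def using assms(2)
    by (intro sum.cong arg_cong2[of _ _ _ _ "(*)"] arg_cong[of _ _ "\<lambda>A. real (card A)"] refl) auto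
  also have "\<dots> = (\<Sum>j\<in>?S. ?g j)"
    by (rule sum.group[OF fin img])
  finally show ?thesis .
qed

lemma cost_ge:
  assumes "valid_instance I" "\<psi> \<in> assignments I" "k \<in> scenario_indices I"
  shows "(\<Sum>j\<in>scenario I k.
      weight I j * real (card {x \<in> scenario I k. x < j} div num_machines I + 1)) \<le> cost I \<psi> k"
proof -
  let ?S = "scenario I k"
  let ?m = "num_machines I"
  let ?c = "\<lambda>j. card {x \<in> ?S. \<psi> x = \<psi> j \<and> x \<le> j}"
  let ?b = "\<lambda>j. card {x \<in> ?S. x < j} div ?m + 1"
  \<comment> \<open>Extending the excess over the bound by 0 outside the scenario lets the Abel
    summation run over all jobs.\<close>
  define d where "d = (\<lambda>j. if j \<in> ?S then real (?c j) - real (?b j) else 0)"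
  have sub: "?S \<subseteq> {1..num_jobs I}" and m: "1 \<le> ?m"
    using assms by (auto simp: valid_instance_def jobs_def)
  have "0 \<le> (\<Sum>j=1..num_jobs I. weight I j * d j)"
  proof (rule sum_antitone_weights_nonneg)
    fix j
    show "weight I (Suc j) \<le> weight I j" if "1 \<le> j" "j < num_jobs I"
      using that assms(1) unfolding valid_instance_def jobs_def by auto
    show "0 \<le> weight I j" if "1 \<le> j" "j \<le> num_jobs I"
      using that assms(1) by (auto simp: valid_instance_def jobs_def)
  next
    fix l
    assume "l \<le> num_jobs I"
    \<comment> \<open>Ranks and positions of jobs in this prefix depend only on jobs up to
      \<open>l\<close>, so the unweighted bound for \<open>A\<close> controls the prefix sum of
      \<open>d\<close>.\<close>
    define A where "A = {1..l} \<inter> ?S"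
    have A: "finite A" "\<psi> ` A \<subseteq> machines I"
      using assms(2) sub by (auto simp: A_def assignments_def jobs_def)
    have "(\<Sum>j\<in>A. ?b j) = (\<Sum>j\<in>A. card {x \<in> A. x < j} div ?m + 1)"
      using sub by (intro sum.cong refl arg_cong[of _ _ "\<lambda>B. card B div ?m + 1"])
        (auto simp: A_def)
    also have "\<dots> = (\<Sum>r<card A. r div ?m + 1)"
      by (rule sum_rank[OF A(1)])
    also have "\<dots> \<le> (\<Sum>j\<in>A. card {x \<in> A. \<psi> x = \<psi> j \<and> x \<le> j})"
      using sum_positions_ge[OF A(1) _ _ A(2)] m by (simp add: machines_def)
    also have "\<dots> = (\<Sum>j\<in>A. ?c j)"
      using sub by (intro sum.cong refl arg_cong[of _ _ card]) (auto simp: A_def)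
    finally have "(\<Sum>j\<in>A. real (?b j)) \<le> (\<Sum>j\<in>A. real (?c j))"
      unfolding of_nat_sum[symmetric] by (simp only: of_nat_le_iff)
    moreover have "(\<Sum>j=1..l. d j) = (\<Sum>j\<in>A. real (?c j) - real (?b j))"
      unfolding A_def d_def by (rule sum.inter_restrict[symmetric]) simp
    ultimately show "0 \<le> (\<Sum>j=1..l. d j)"
      by (simp add: sum_subtractf)
  qed
  also have "(\<Sum>j=1..num_jobs I. weight I j * d j) =
      (\<Sum>j\<in>?S. weight I j * (real (?c j) - real (?b j)))"
    using sub by (intro sum.mono_neutral_cong_right) (auto simp: d_def)
  also have "\<dots> = cost I \<psi> k - (\<Sum>j\<in>?S. weight I j * real (?b j))"
    using assms sub by (simp add: cost_eq_sum_positions jobs_def right_diff_distrib sum_subtractf)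
  finally show ?thesis by simp
qed

section \<open>The zigzag assignment\<close>

text \<open>Integer labels whose residues modulo the number of machines select the machine. With
  \<open>D\<close> the intersection of both scenarios, a common job has the same label in
  either.\<close>

definition zigzag :: "nat set \<Rightarrow> nat set \<Rightarrow> nat \<Rightarrow> int" where
  "zigzag S D j = (if j \<in> D then int (card {x \<in> D. x < j})
     else - 1 - int (card {x \<in> S - D. x < j}))"

text \<open>Measures how the count of a residue class changes when an interval of integers grows by
  one element at an end.\<close>

lemma div_add1_int:
  fixes z m :: int
  assumes "0 < m"
  shows "(z + 1) div m = z div m + of_bool (m dvd z + 1)"
proof (cases "m dvd z + 1")
  case True
  then obtain q where q: "z + 1 = m * q" by blast
  then have "z = m * (q - 1) + (m - 1)" by (simp add: algebra_simps)
  then have "z div m = q - 1" using assms by simp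
  moreover have "(z + 1) div m = q" using q assms by simp
  ultimately show ?thesis using True by simp
next
  case False
  have "(z + 1) mod m \<noteq> 0" "0 \<le> (z + 1) mod m" "(z + 1) mod m < m"
    using False assms by (auto simp: dvd_eq_mod_eq_0)
  then have "0 \<le> (z + 1) mod m - 1" "(z + 1) mod m - 1 < m"
    by linarith+
  moreover have "z = m * ((z + 1) div m) + ((z + 1) mod m - 1)"
    using mult_div_mod_eq[of m "z + 1"] by linarith
  ultimately have "z div m = (z + 1) div m"
    by (intro int_div_pos_eq)
  then show ?thesis using False by simp
qed

text \<open>The reflection of u to -1 - u maps blocks of length m to blocks and reverses each, so
  descending labels visit the machines from the last one down.\<close>

lemma minus1_minus_div_mod:
  fixes u m :: int
  assumes "0 < m"
  shows "(- 1 - u) div m = - (u div m) - 1" and "(- 1 - u) mod m = m - 1 - u mod m"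
proof -
  have eq: "- 1 - u = m * (- (u div m) - 1) + (m - 1 - u mod m)"
    using mult_div_mod_eq[of m u] by (simp add: algebra_simps)
  have "0 \<le> m - 1 - u mod m" "m - 1 - u mod m < m"
    using pos_mod_sign[OF assms, of u] pos_mod_bound[OF assms, of u] by auto
  then show "(- 1 - u) div m = - (u div m) - 1" "(- 1 - u) mod m = m - 1 - u mod m"
    by (rule int_div_pos_eq[OF eq], rule int_mod_pos_eq[OF eq])
qed

lemma card_less_Suc:
  "card {x \<in> A. x < Suc n \<and> P x} = card {x \<in> A. x < n \<and> P x} + of_bool (n \<in> A \<and> P n)"
proof -
  have "{x \<in> A. x < Suc n \<and> P x} = {x \<in> A. x < n \<and> P x} \<union> (if n \<in> A \<and> P n then {n} else {})"
    by (auto simp: less_Suc_eq)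
  then show ?thesis by (auto simp: card_insert_if)
qed

lemmas card_less_Suc' = card_less_Suc[where P = "\<lambda>_. True", simplified]

text \<open>The zigzag values of the elements below \<open>n\<close> fill an interval of integers around \<open>0\<close>, whose elements
  congruent to \<open>z\<close> are counted by a difference of two quotients.\<close>

lemma card_zigzag_cong:
  fixes m :: int
  assumes "0 < m" "D \<subseteq> S"
  shows "int (card {x \<in> S. x < n \<and> m dvd zigzag S D x - z}) =
    (int (card {x \<in> D. x < n}) - 1 - z) div m - (- int (card {x \<in> S - D. x < n}) - 1 - z) div m"
proof (induction n)
  case 0
  then show ?case by simp
next
  case (Suc n)
  define t where "t = (\<lambda>n. card {x \<in> D. x < n})"
  define u where "u = (\<lambda>n. card {x \<in> S - D. x < n})"
  have t: "t (Suc n) = t n + of_bool (n \<in> D)"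
    unfolding t_def by (rule card_less_Suc')
  have u: "u (Suc n) = u n + of_bool (n \<in> S - D)"
    unfolding u_def by (rule card_less_Suc')
  have IH: "int (card {x \<in> S. x < n \<and> m dvd zigzag S D x - z}) =
      (int (t n) - 1 - z) div m - (- int (u n) - 1 - z) div m"
    using Suc unfolding t_def u_def .
  \<comment> \<open>The labels seen so far fill the interval from -u to t - 1. A job of
    \<open>D\<close> appends t at the top, any other job of \<open>S\<close> appends -1 - u at the
    bottom.\<close>
  have up: "(int (t n + 1) - 1 - z) div m =
      (int (t n) - 1 - z) div m + of_bool (m dvd int (t n) - z)"
    using div_add1_int[OF assms(1), of "int (t n) - 1 - z"] by simp
  have down: "(- int (u n) - 1 - z) div m =
      (- int (u n + 1) - 1 - z) div m + of_bool (m dvd - 1 - int (u n) - z)"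
  proof -
    have "- int (u n) - 2 - z + 1 = - int (u n) - 1 - z"
      "- int (u n + 1) - 1 - z = - int (u n) - 2 - z" "- 1 - int (u n) - z = - int (u n) - 1 - z"
      by simp_all
    then show ?thesis
      using div_add1_int[OF assms(1), of "- int (u n) - 2 - z"] by (simp only:)
  qed
  consider "n \<in> D" "n \<in> S" "zigzag S D n = int (t n)"
    | "n \<in> S" "n \<notin> D" "zigzag S D n = - 1 - int (u n)" | "n \<notin> S" "n \<notin> D"
    using assms(2) by (auto simp: zigzag_def t_def u_def)
  then have "int (card {x \<in> S. x < n \<and> m dvd zigzag S D x - z}) +
      of_bool (n \<in> S \<and> m dvd zigzag S D n - z) =
      (int (t (Suc n)) - 1 - z) div m - (- int (u (Suc n)) - 1 - z) div m"
  proof cases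
    case 1
    then have "t (Suc n) = t n + 1" "u (Suc n) = u n"
      "(n \<in> S \<and> m dvd zigzag S D n - z) = (m dvd int (t n) - z)"
      using t u by simp_all
    then show ?thesis
      by (simp only: IH up)
  next
    case 2
    then have "t (Suc n) = t n" "u (Suc n) = u n + 1"
      "(n \<in> S \<and> m dvd zigzag S D n - z) = (m dvd - 1 - int (u n) - z)"
      using t u by simp_all
    then show ?thesis
      using down by (simp only: IH)
  next
    case 3
    then show ?thesis
      using IH t u by simp
  qed
  then show ?case
    unfolding card_less_Suc t_def u_def by simp
qed

text \<open>The label of j extends the interval of earlier labels at one end. Of the two quotients
  in \<open>card_zigzag_cong\<close>, one is then constant (-1 or 0), and their difference is the
  rank of j divided by m; counting j itself adds 1.\<close>

lemma zigzag_position: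
  fixes m :: nat
  assumes "0 < m" "D \<subseteq> S" "j \<in> S"
  shows "card {x \<in> S. int m dvd zigzag S D x - zigzag S D j \<and> x \<le> j} =
    card {x \<in> S. x < j} div m + 1"
proof -
  let ?z = "zigzag S D j"
  let ?t = "card {x \<in> D. x < j}"
  let ?u = "card {x \<in> S - D. x < j}"
  have "{x \<in> S. x < j} = {x \<in> D. x < j} \<union> {x \<in> S - D. x < j}"
    using assms(2) by auto
  then have r: "card {x \<in> S. x < j} = ?t + ?u"
    by (simp only:) (rule card_Un_disjoint, auto)
  have "int (card {x \<in> S. x < j \<and> int m dvd zigzag S D x - ?z}) =
      (int ?t - 1 - ?z) div int m - (- int ?u - 1 - ?z) div int m"
    using assms by (intro card_zigzag_cong) auto
  also have "\<dots> = (int ?t + int ?u) div int m"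
  proof (cases "j \<in> D")
    case True
    have "(- 1) div int m = - 1"
      using assms(1) by (simp add: div_eq_minus1)
    moreover have "(- int ?u - 1 - int ?t) div int m = - ((int ?t + int ?u) div int m) - 1"
      using minus1_minus_div_mod(1)[of "int m" "int ?t + int ?u"] assms(1)
      by (simp only: of_nat_0_less_iff diff_diff_eq minus_add_distrib diff_conv_add_uminus ac_simps)
    ultimately show ?thesis using True by (simp add: zigzag_def)
  next
    case False
    then show ?thesis by (simp add: zigzag_def)
  qed
  also have "\<dots> = int (card {x \<in> S. x < j} div m)"
    by (simp add: r zdiv_int)
  finally have "card {x \<in> S. x < j \<and> int m dvd zigzag S D x - ?z} = card {x \<in> S. x < j} div m"
    by simp
  then show ?thesis
    using card_less_Suc[of S j "\<lambda>x. int m dvd zigzag S D x - ?z"] assms(3)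
    by (simp add: less_Suc_eq_le conj_commute)
qed

section \<open>The assignment to machines and its optimality in both scenarios\<close>

definition job_class :: "stc_instance \<Rightarrow> nat \<Rightarrow> nat" where
  "job_class I j = of_bool (j \<in> scenario I 1) + 2 * of_bool (j \<in> scenario I 2)"

definition class_count :: "stc_instance \<Rightarrow> nat \<Rightarrow> nat \<Rightarrow> nat" where
  "class_count I c j = card {x \<in> jobs I. x < j \<and> job_class I x = c}"

text \<open>Class 3 ascends from machine 1 and every other class descends from the last machine, so
  a single test for class 3 decides the direction.\<close>

definition zigzag_assignment :: "stc_instance \<Rightarrow> nat \<Rightarrow> nat" where
  "zigzag_assignment I = restrict (\<lambda>j.
     let x = class_count I (job_class I j) j mod num_machines I
     in if job_class I j = 3 then x + 1 else num_machines I - x) (jobs I)"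

lemma zigzag_assignment_in_assignments:
  assumes "valid_instance I"
  shows "zigzag_assignment I \<in> assignments I"
proof -
  have "0 < num_machines I" using assms by (simp add: valid_instance_def)
  then have "x mod num_machines I < num_machines I" for x by simp
  then show ?thesis
    by (auto simp: zigzag_assignment_def assignments_def machines_def Let_def Suc_le_eq)
qed

text \<open>Inside scenario k the common jobs are class 3 and the rest are class k, so class counts
  agree with the counts in \<open>zigzag\<close>. The shift by 1 arises because machines are
  numbered from 1.\<close>

lemma zigzag_assignment_eq:
  assumes "valid_instance I" "k \<in> {1, 2}" "num_scenarios I = 2" "j \<in> scenario I k"
  shows "int (zigzag_assignment I j) =
    zigzag (scenario I k) (scenario I 1 \<inter> scenario I 2) j mod int (num_machines I) + 1"
proof -
  have sub: "scenario I 1 \<subseteq> jobs I" "scenario I 2 \<subseteq> jobs I"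
    using assms by (auto simp: valid_instance_def scenario_indices_def)
  have m: "0 < num_machines I" using assms(1) by (simp add: valid_instance_def)
  have j: "j \<in> jobs I" using assms(2,4) sub by auto
  show ?thesis
  proof (cases "j \<in> scenario I 1 \<inter> scenario I 2")
    case True
    have "{x \<in> jobs I. x < j \<and> job_class I x = 3} = {x \<in> scenario I 1 \<inter> scenario I 2. x < j}"
      using sub by (auto simp: job_class_def of_bool_def split: if_splits)
    moreover have "job_class I j = 3"
      using True by (simp add: job_class_def)
    ultimately show ?thesis
      using True j unfolding zigzag_def
      by (simp only: zigzag_assignment_def class_count_def Let_def zmod_int restrict_apply
          if_True simp_thms of_nat_add of_nat_1)
  next
    case False
    have c: "job_class I j = k"
      using False assms(2,4) by (auto simp: job_class_def)
    have "{x \<in> jobs I. x < j \<and> job_class I x = k} =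
        {x \<in> scenario I k - scenario I 1 \<inter> scenario I 2. x < j}"
      using sub assms(2) by (auto simp: job_class_def of_bool_def split: if_splits)
    moreover have "int (num_machines I - u mod num_machines I) =
        (- 1 - int u) mod int (num_machines I) + 1" for u
      using minus1_minus_div_mod(2)[of "int (num_machines I)" "int u"] m
      by (simp add: zmod_int)
    moreover have "k \<noteq> 3" using assms(2) by auto
    ultimately show ?thesis
      using False j c unfolding zigzag_def
      by (simp only: zigzag_assignment_def class_count_def Let_def restrict_apply if_True if_False)
  qed
qed

text \<open>Jobs of a scenario share a machine iff their labels are congruent, so
  \<open>zigzag_position\<close> makes the lower bound of \<open>cost_ge\<close> an
  equality.\<close>

lemma cost_zigzag_assignment:
  assumes "valid_instance I" "k \<in> {1, 2}" "num_scenarios I = 2"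
  shows "cost I (zigzag_assignment I) k = (\<Sum>j\<in>scenario I k.
      weight I j * real (card {x \<in> scenario I k. x < j} div num_machines I + 1))"
proof -
  let ?S = "scenario I k"
  let ?D = "scenario I 1 \<inter> scenario I 2"
  let ?\<phi> = "zigzag_assignment I"
  have m: "0 < num_machines I" and S: "?S \<subseteq> jobs I"
    using assms by (auto simp: valid_instance_def scenario_indices_def)
  have "{x \<in> ?S. ?\<phi> x = ?\<phi> j \<and> x \<le> j} =
      {x \<in> ?S. int (num_machines I) dvd zigzag ?S ?D x - zigzag ?S ?D j \<and> x \<le> j}"
    if "j \<in> ?S" for j
  proof -
    have "?\<phi> x = ?\<phi> j \<longleftrightarrow> int (num_machines I) dvd zigzag ?S ?D x - zigzag ?S ?D j"
      if "x \<in> ?S" for x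
      using zigzag_assignment_eq[OF assms that] zigzag_assignment_eq[OF assms \<open>j \<in> ?S\<close>]
      by (simp flip: of_nat_eq_iff[where 'a = int] mod_eq_dvd_iff)
    then show ?thesis by auto
  qed
  then show ?thesis
    using zigzag_position[OF m, of ?D ?S] assms(2)
    by (auto simp: cost_eq_sum_positions[OF zigzag_assignment_in_assignments[OF assms(1)] S]
        intro!: sum.cong)
qed

lemma zigzag_assignment_optimal:
  assumes "valid_instance I" "num_scenarios I = 2" "k \<in> {1, 2}" "\<psi> \<in> assignments I"
  shows "cost I (zigzag_assignment I) k \<le> cost I \<psi> k"
  using cost_ge[OF assms(1,4), of k] cost_zigzag_assignment[OF assms(1,3,2)] assms(2,3)
  by (auto simp: scenario_indices_def)

lemma is_minimizerI:
  assumes "\<phi> \<in> assignments I" "\<And>\<psi>. \<psi> \<in> assignments I \<Longrightarrow> f \<phi> \<le> f \<psi>"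
  shows "is_minimizer I f \<phi>"
proof -
  have "finite (assignments I)"
    by (auto simp: assignments_def jobs_def machines_def intro: finite_PiE)
  then show ?thesis
    using assms by (auto simp: is_minimizer_def intro!: Min_eqI[symmetric])
qed

section \<open>The random access machine program\<close>

text \<open>Cells 0 to 3 hold the class counters modulo the number of machines, cell 4 the number of
  remaining jobs, cell 5 the number of machines, cells 6 and 7 the positions of the current job in
  the two bit vectors, and cell 8 the constant 1. The loop over the jobs starts at
  instruction 5; class 3, the jobs common to both scenarios, branches to instruction 17.\<close>

definition zigzag_program :: "instr list" where
  "zigzag_program =
    [Const 8 1, Read 5 8, Read 4 0, Const 6 3, Add 7 6 4,
     Jump 4 7, Jump 8 28,
     Read 9 6, Read 10 7, Add 9 9 10, Add 9 9 10,
     Load 11 9, Const 12 2, Sub 12 9 12, Jump 12 17,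
     Sub 13 5 11, Jump 8 18,
     Add 13 11 8,
     Print 13, Add 11 11 8, Sub 13 5 11, Jump 13 23,
     Const 11 0,
     Store 9 11, Add 6 6 8, Add 7 7 8, Sub 4 4 8, Jump 8 5]"

text \<open>Peels off the first step, so that simplification runs the program forward from a known
  configuration.\<close>

lemma funpow_numeral_apply: "(f ^^ numeral k) x = (f ^^ pred_numeral k) (f x)"
  by (simp add: numeral_eq_Suc funpow_swap1)

lemma step_program:
  "step zigzag_program xs ws s =
    (if pc s < 28 then exec xs ws (zigzag_program ! pc s) s else s)"
  by (simp add: step_def halted_def zigzag_program_def)

text \<open>Unfolds the program only where an instruction is fetched.\<close>

lemmas program_nth = zigzag_program_def[THEN arg_cong[where f = nth], THEN fun_cong]

text \<open>Symbolic execution of one pass. Truncated c - 2 is positive only for class 3, whose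
  branch saves one jump; resetting a counter that reaches \<open>N 5\<close> costs one more
  instruction.\<close>

lemma loop_body:
  fixes N :: "nat \<Rightarrow> nat"
  assumes "0 < N 4" "N 8 = 1" "input_at xs (N 6) = b" "input_at xs (N 7) = b'"
    and "b = 0 \<or> b = 1" "b' = 0 \<or> b' = 1" "c = b + 2 * b'"
    and "x = (if Suc (N c) < N 5 then Suc (N c) else 0)"
    and "t = (if c = 3 then 19 else 20) + (if Suc (N c) < N 5 then 0 else 1)"
  shows "(step zigzag_program xs ws ^^ t) \<lparr>pc = 5, nmem = N, rmem = R, out = ys\<rparr> =
      \<lparr>pc = 5, nmem = N(10 := b', 9 := c, 12 := c - 2, 13 := N 5 - Suc (N c), 11 := x, c := x,
          6 := N 6 + 1, 7 := N 7 + 1, 4 := N 4 - 1),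
        rmem = R, out = ys @ [if c = 3 then Suc (N c) else N 5 - N c]\<rparr>"
proof -
  note run = funpow_numeral_apply step_program program_nth fun_upd_twist[of 13 11]
    numeral_2_eq_2[symmetric]
  \<comment> \<open>The class is the address of its counter; fixing it makes the counter address
    literal, so memory updates can be compared.\<close>
  consider "b = 0" "b' = 0" "c = 0" | "b = 1" "b' = 0" "c = 1"
    | "b = 0" "b' = 1" "c = 2" | "b = 1" "b' = 1" "c = 3"
    using assms(5-7) by fastforce
  then show ?thesis
  proof cases
    case 1
    show ?thesis
      unfolding assms(8,9) 1
      by (cases "Suc (N 0) < N 5") (simp_all add: run assms(1-4)[unfolded 1])
  next
    case 2
    show ?thesis
      unfolding assms(8,9) 2
      by (cases "Suc (N 1) < N 5") (simp_all add: run assms(1-4)[unfolded 2])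
  next
    case 3
    show ?thesis
      unfolding assms(8,9) 3
      by (cases "Suc (N 2) < N 5") (simp_all add: run assms(1-4)[unfolded 3])
  next
    case 4
    show ?thesis
      unfolding assms(8,9) 4
      by (cases "Suc (N 3) < N 5") (simp_all add: run assms(1-4)[unfolded 4])
  qed
qed

text \<open>Loop invariant after j jobs. \<open>class_count\<close> counts strictly below its
  argument, hence j + 1; the offset 3 skips the sizes at the head of the input. Scratch cells 9 to
  13 are left unconstrained.\<close>

definition loop_state :: "stc_instance \<Rightarrow> nat \<Rightarrow> config \<Rightarrow> bool" where
  "loop_state I j s \<longleftrightarrow> pc s = 5 \<and>
     (\<forall>c<4. nmem s c = class_count I c (j + 1) mod num_machines I) \<and>
     nmem s 4 = num_jobs I - j \<and> nmem s 5 = num_machines I \<and>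
     nmem s 6 = 3 + j \<and> nmem s 7 = 3 + num_jobs I + j \<and> nmem s 8 = 1 \<and>
     out s = map (zigzag_assignment I) [1..<j + 1]"

lemma input_at_encode_nat:
  assumes "num_scenarios I = 2"
  shows "input_at (encode_nat I) 0 = num_jobs I"
    and "input_at (encode_nat I) 1 = num_machines I"
    and "j < num_jobs I \<Longrightarrow> input_at (encode_nat I) (3 + j) = of_bool (j + 1 \<in> scenario I 1)"
    and "j < num_jobs I \<Longrightarrow>
      input_at (encode_nat I) (3 + num_jobs I + j) = of_bool (j + 1 \<in> scenario I 2)"
proof -
  let ?bits = "\<lambda>k. map (\<lambda>j. of_bool (j \<in> scenario I k) :: nat) (job_list I)"
  have "[1..<num_scenarios I + 1] = [1, 2]"
    using assms by (simp add: upt_rec)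
  then have eq: "encode_nat I =
      [num_jobs I, num_machines I, num_scenarios I] @ ?bits 1 @ ?bits 2"
    by (simp add: encode_nat_def)
  have len: "length (job_list I) = num_jobs I"
    by (simp add: job_list_def)
  have nth: "job_list I ! j = j + 1" if "j < num_jobs I" for j
    using that by (simp add: job_list_def del: upt_Suc)
  show "input_at (encode_nat I) 0 = num_jobs I" "input_at (encode_nat I) 1 = num_machines I"
    by (simp_all add: eq input_at_def)
  assume "j < num_jobs I"
  then show "input_at (encode_nat I) (3 + j) = of_bool (j + 1 \<in> scenario I 1)"
    "input_at (encode_nat I) (3 + num_jobs I + j) = of_bool (j + 1 \<in> scenario I 2)"
    using len nth by (simp_all add: eq input_at_def nth_append)
qed

lemma class_count_Suc:
  assumes "j \<in> jobs I"
  shows "class_count I c (Suc j) = class_count I c j + of_bool (job_class I j = c)"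
  unfolding class_count_def using card_less_Suc assms by simp

text \<open>The longest pass has 21 instructions: a job outside class 3 whose counter is
  reset.\<close>

lemma loop_iteration:
  assumes "num_scenarios I = 2" "0 < num_machines I" "j < num_jobs I" "loop_state I j s"
  shows "\<exists>t\<le>21. loop_state I (Suc j)
    ((step zigzag_program (encode_nat I) (encode_weights I) ^^ t) s)"
proof -
  let ?xs = "encode_nat I" and ?m = "num_machines I"
  define c where "c = job_class I (Suc j)"
  define b where "b = (\<lambda>k. of_bool (Suc j \<in> scenario I k) :: nat)"
  define N where "N = nmem s"
  define x where "x = class_count I c (Suc j) mod ?m"
  \<comment> \<open>Since x < m, this is \<open>Suc x\<close> modulo m, obtained by a comparison
    instead of a division.\<close>
  define x' where "x' = (if Suc x < ?m then Suc x else 0)"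
  define t :: nat where "t = (if c = 3 then 19 else 20) + (if Suc x < ?m then 0 else 1)"
  define N' where "N' = N(10 := b 2, 9 := c, 12 := c - 2, 13 := N 5 - Suc (N c), 11 := x', c := x',
    6 := N 6 + 1, 7 := N 7 + 1, 4 := N 4 - 1)"
  have job: "Suc j \<in> jobs I" using assms(3) by (simp add: jobs_def)
  have c: "c = b 1 + 2 * b 2" by (simp add: c_def job_class_def b_def)
  have c4: "c < 4" by (simp add: c b_def)
  have s: "s = \<lparr>pc = 5, nmem = N, rmem = rmem s, out = map (zigzag_assignment I) [1..<j + 1]\<rparr>"
    using assms(4) by (simp add: loop_state_def N_def)
  have cells: "N 4 = num_jobs I - j" "N 5 = ?m" "N 6 = 3 + j" "N 7 = 3 + num_jobs I + j" "N 8 = 1"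
    and counts: "\<And>c. c < 4 \<Longrightarrow> N c = class_count I c (Suc j) mod ?m"
    using assms(4) by (simp_all add: loop_state_def N_def)
  have read: "input_at ?xs (N 6) = b 1" "input_at ?xs (N 7) = b 2"
    using input_at_encode_nat(3,4)[OF assms(1,3)] by (simp_all add: b_def cells)
  have Nc: "N c = x" using counts[OF c4] by (simp add: x_def)
  have assign: "zigzag_assignment I (Suc j) = (if c = 3 then Suc (N c) else N 5 - N c)"
    unfolding Nc cells using job by (simp add: zigzag_assignment_def x_def c_def Let_def)
  have run: "(step zigzag_program ?xs (encode_weights I) ^^ t) s =
    \<lparr>pc = 5, nmem = N', rmem = rmem s,
      out = map (zigzag_assignment I) [1..<j + 1] @ [zigzag_assignment I (Suc j)]\<rparr>"
    unfolding assign N'_def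
    by (subst s, subst loop_body[OF _ cells(5) read _ _ c, of x' t])
      (use assms(3) in \<open>simp_all add: cells Nc x'_def t_def b_def\<close>)
  have "x < ?m" using assms(2) by (simp add: x_def)
  then have "N' d = class_count I d (Suc (Suc j)) mod ?m" if "d < 4" for d
    using that counts[OF that] c4
    by (auto simp: N'_def class_count_Suc[OF job] mod_Suc x'_def x_def simp flip: c_def)
  then have "loop_state I (Suc j) ((step zigzag_program ?xs (encode_weights I) ^^ t) s)"
    unfolding run using cells c4 by (simp add: loop_state_def N'_def)
  then show ?thesis
    by (intro exI[of _ t]) (simp add: t_def)
qed

text \<open>Five instructions precede the loop; the counters are correct at 0 because no job
  precedes job 1.\<close>

lemma loop_state_initial:
  assumes "num_scenarios I = 2"
  shows "loop_state I 0 ((step zigzag_program (encode_nat I) (encode_weights I) ^^ 5) initial_config)"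
proof -
  have "class_count I c (Suc 0) = 0" for c
    by (auto simp: class_count_def jobs_def)
  then show ?thesis
    using input_at_encode_nat(1,2)[OF assms]
    by (simp add: funpow_numeral_apply step_def halted_def zigzag_program_def loop_state_def
        less_Suc_eq numeral_eq_Suc initial_config_def)
qed

lemma loop_state_reached:
  assumes "num_scenarios I = 2" "0 < num_machines I" "j \<le> num_jobs I"
  shows "\<exists>t\<le>21 * j + 5. loop_state I j
    ((step zigzag_program (encode_nat I) (encode_weights I) ^^ t) initial_config)"
  using assms(3)
proof (induction j)
  case 0
  then show ?case
    using loop_state_initial[OF assms(1)] by auto
next
  case (Suc j)
  then obtain t t' where "t \<le> 21 * j + 5" "t' \<le> 21" "loop_state I (Suc j)
    ((step zigzag_program (encode_nat I) (encode_weights I) ^^ (t' + t)) initial_config)"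
    using loop_iteration[OF assms(1,2)] unfolding funpow_add comp_apply
    by (meson Suc_leD Suc_le_lessD)
  then show ?case
    by (intro exI[of _ "t' + t"]) simp
qed

section \<open>Halting, the linear time bound and the theorem\<close>

lemma halted_funpow_step: "halted P s \<Longrightarrow> (step P xs ws ^^ t) s = s"
  by (induction t) (simp_all add: step_def)

text \<open>The number of executed steps depends on the scenarios, while the time bound may depend
  only on the number of jobs.\<close>

lemma outputs_within_mono:
  assumes "outputs_within P xs ws t ys" "t \<le> t'"
  shows "outputs_within P xs ws t' ys"
proof -
  have "(step P xs ws ^^ t') initial_config =
      (step P xs ws ^^ (t' - t)) ((step P xs ws ^^ t) initial_config)"
    using assms(2) by (simp flip: funpow_add comp_apply[of "_ ^^ _"])
  then show ?thesis
    using assms(1) by (simp add: outputs_within_def Let_def halted_funpow_step)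
qed

lemma zigzag_program_computes:
  assumes "num_scenarios I = 2" "0 < num_machines I"
  shows "computes_assignment_within zigzag_program I (21 * num_jobs I + 7) (zigzag_assignment I)"
proof -
  let ?step = "step zigzag_program (encode_nat I) (encode_weights I)"
  obtain t where t: "t \<le> 21 * num_jobs I + 5"
    and loop: "loop_state I (num_jobs I) ((?step ^^ t) initial_config)"
    using loop_state_reached[OF assms order_refl] by blast
  define s where "s = (?step ^^ t) initial_config"
  \<comment> \<open>With no job left, the test of cell 4 falls through and the next jump leaves the
    program: two steps.\<close>
  have "halted zigzag_program ((?step ^^ 2) s)"
    "out ((?step ^^ 2) s) = encode_assignment I (zigzag_assignment I)"
    using loop unfolding s_def[symmetric] loop_state_def
    by (simp_all add: funpow_numeral_apply step_def halted_def zigzag_program_def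
        encode_assignment_def job_list_def)
  then have "outputs_within zigzag_program (encode_nat I) (encode_weights I) (2 + t)
      (encode_assignment I (zigzag_assignment I))"
    by (simp only: outputs_within_def Let_def funpow_add comp_apply s_def simp_thms)
  then show ?thesis
    unfolding computes_assignment_within_def using t by (elim outputs_within_mono) simp
qed

theorem theorem1:
  "\<exists>(P :: instr list) (T :: nat \<Rightarrow> nat).
     (\<lambda>n. real (T n)) \<in> O(\<lambda>n. real n) \<and>
     (\<forall>I :: stc_instance. valid_instance I \<and> num_scenarios I = 2 \<longrightarrow>
        (\<exists>\<phi> \<in> assignments I.
           computes_assignment_within P I (T (num_jobs I)) \<phi> \<and>
           scenario_optimal I 1 \<phi> \<and> scenario_optimal I 2 \<phi> \<and>
           MinMaxSTC_optimal I \<phi> \<and> MinAvgSTC_optimal I \<phi>))"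
proof (intro exI conjI allI impI)
  \<comment> \<open>For n at least 1, 21 n + 7 is at most (21 + 7) n.\<close>
  have "eventually (\<lambda>n. norm (real (21 * n + 7)) \<le> 28 * norm (real n)) at_top"
    using eventually_ge_at_top[of "1::nat"] by eventually_elim simp
  then show "(\<lambda>n. real (21 * n + 7)) \<in> O(\<lambda>n. real n)"
    by (rule bigoI)
next
  fix I
  assume I: "valid_instance I \<and> num_scenarios I = 2"
  let ?\<phi> = "zigzag_assignment I"
  have \<phi>: "?\<phi> \<in> assignments I"
    using I zigzag_assignment_in_assignments by blast
  have K: "scenario_indices I = {1, 2}"
    using I by (auto simp: scenario_indices_def)
  have opt: "cost I ?\<phi> k \<le> cost I \<psi> k" if "k \<in> {1, 2}" "\<psi> \<in> assignments I" for k \<psi>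
    using zigzag_assignment_optimal I that by blast
  have "scenario_optimal I k ?\<phi>" if "k \<in> {1, 2}" for k
    unfolding scenario_optimal_def using opt[OF that] by (rule is_minimizerI[OF \<phi>])
  moreover have "MinMaxSTC_optimal I ?\<phi>"
    unfolding MinMaxSTC_optimal_def K
  proof (rule is_minimizerI[OF \<phi>])
    fix \<psi>
    assume "\<psi> \<in> assignments I"
    then have "max (cost I ?\<phi> 1) (cost I ?\<phi> 2) \<le> max (cost I \<psi> 1) (cost I \<psi> 2)"
      by (intro max.mono opt) auto
    then show "Max (cost I ?\<phi> ` {1, 2}) \<le> Max (cost I \<psi> ` {1, 2})"
      by simp
  qed
  moreover have "MinAvgSTC_optimal I ?\<phi>"
    unfolding MinAvgSTC_optimal_def K using opt by (intro is_minimizerI[OF \<phi>] sum_mono)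
  moreover have "computes_assignment_within zigzag_program I (21 * num_jobs I + 7) ?\<phi>"
    using I by (intro zigzag_program_computes) (auto simp: valid_instance_def)
  ultimately show "\<exists>\<phi>\<in>assignments I.
      computes_assignment_within zigzag_program I (21 * num_jobs I + 7) \<phi> \<and>
      scenario_optimal I 1 \<phi> \<and> scenario_optimal I 2 \<phi> \<and>
      MinMaxSTC_optimal I \<phi> \<and> MinAvgSTC_optimal I \<phi>"
    using \<phi> by blast
qed

end
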